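(* Let $m\in\mathbb N$, $p\ge 1$, $\theta>0$, let $\|\cdot\|$ be any norm on $\mathbb R^m$, and let $\mathbb P'\in\mathcal P_p(\mathbb R^m)$. Then $$\mathcal M_{\theta,p}(\mathbb P') = B_\theta\big(\mathbb E_{\mathbb P'}[\tilde{\boldsymbol\xi}']\big),$$ independently of $p$. Here $\mathcal M_{\theta,p}(\mathbb P')=\{\mathbf y\in\mathbb R^m:\ \mathbf y=\mathbb E_{\mathbb P}[\tilde{\boldsymbol\xi}]\text{ for some }\mathbb P\in\mathbb B_{\theta,p}(\mathbb P')\}$ is the set of means of all distributions in the $p$-Wasserstein ball of radius $\theta$ around $\mathbb P'$, and $B_\theta(\mathbf w)=\{\mathbf y\in\mathbb R^m:\|\mathbf y-\mathbf w\|\le\theta\}$.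
   Context: $\mathcal P(\mathbb R^m)$ is the set of Borel probability measures on $\mathbb R^m$ and $\mathcal P_p(\mathbb R^m)$ the subset of those with $\mathbb E_{\mathbb P}[\|\tilde{\boldsymbol\xi}\|^p]<\infty$. $\mathbb E_{\mathbb P}[\tilde{\boldsymbol\xi}]$ is the mean of a random vector with law $\mathbb P$ (and $\mathbb E_{\mathbb P'}[\tilde{\boldsymbol\xi}']$ the mean of $\mathbb P'$). The $p$-Wasserstein distance (with respect to the norm $\|\cdot\|$) is $$W_p(\mathbb P,\mathbb P')=\Big(\inf_{\pi\in\Pi(\mathbb P,\mathbb P')}\int\|\boldsymbol\xi-\boldsymbol\xi'\|^p\,\mathrm d\pi(\boldsymbol\xi,\boldsymbol\xi')\Big)^{1/p},$$ with $\Pi(\mathbb P,\mathbb P')$ the set of couplings of $\mathbb P$ and $\mathbb P'$. The Wasserstein ball is $\mathbb B_{\theta,p}(\mathbb P')=\{\mathbb P\in\mathcal P(\mathbb R^m): W_p(\mathbb P,\mathbb P')\le\theta\}\subseteq \mathcal P_p(\mathbb R^m)$. *)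

theory Defs
  imports "HOL-Probability.Probability"
begin

text \<open>An arbitrary norm on \<open>real ^ 'm\<close> is a function argument \<open>N\<close>, since the constant
  \<^const>\<open>norm\<close> is fixed to be the Euclidean norm. All norms on this space induce the same
  topology, so \<^const>\<open>borel\<close> is the right sigma-algebra for every \<open>N\<close>.\<close>

definition is_norm :: "('a::real_vector \<Rightarrow> real) \<Rightarrow> bool" where
  "is_norm N \<longleftrightarrow>
     (\<forall>x. 0 \<le> N x) \<and>
     (\<forall>x. N x = 0 \<longleftrightarrow> x = 0) \<and>
     (\<forall>c x. N (c *\<^sub>R x) = \<bar>c\<bar> * N x) \<and>
     (\<forall>x y. N (x + y) \<le> N x + N y)"

definition norm_ball :: "('a::real_vector \<Rightarrow> real) \<Rightarrow> real \<Rightarrow> 'a \<Rightarrow> 'a set" where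
  "norm_ball N \<theta> w = {y. N (y - w) \<le> \<theta>}"

definition borel_prob :: "'a::topological_space measure set" where
  "borel_prob = {P. prob_space P \<and> sets P = sets borel}"

definition borel_prob_moment ::
    "('a::euclidean_space \<Rightarrow> real) \<Rightarrow> real \<Rightarrow> 'a measure set" where
  "borel_prob_moment N p =
     {P \<in> borel_prob. (\<integral>\<^sup>+ x. ennreal (N x powr p) \<partial>P) < \<infinity>}"

definition couplings ::
    "'a::euclidean_space measure \<Rightarrow> 'a measure \<Rightarrow> ('a \<times> 'a) measure set" where
  "couplings P P' =
     {\<pi>. prob_space \<pi> \<and> sets \<pi> = sets (borel \<Otimes>\<^sub>M borel) \<and>
         distr \<pi> borel fst = P \<and> distr \<pi> borel snd = P'}"

text \<open>Real powers of extended nonnegative reals, meant for exponents \<open>a > 0\<close>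
  (so that infinity is mapped to infinity).\<close>

definition ennreal_powr :: "ennreal \<Rightarrow> real \<Rightarrow> ennreal" where
  "ennreal_powr t a = (if t = \<infinity> then \<infinity> else ennreal (enn2real t powr a))"

text \<open>The distance takes values in \<^typ>\<open>ennreal\<close>, because two arbitrary Borel probability
  measures may be infinitely far apart.\<close>

definition wasserstein ::
    "('a::euclidean_space \<Rightarrow> real) \<Rightarrow> real \<Rightarrow> 'a measure \<Rightarrow> 'a measure \<Rightarrow> ennreal" where
  "wasserstein N p P P' =
     ennreal_powr
       (INF \<pi>\<in>couplings P P'. \<integral>\<^sup>+ z. ennreal (N (fst z - snd z) powr p) \<partial>\<pi>)
       (1 / p)"

definition wasserstein_ball ::
    "('a::euclidean_space \<Rightarrow> real) \<Rightarrow> real \<Rightarrow> real \<Rightarrow> 'a measure \<Rightarrow> 'a measure set" where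
  "wasserstein_ball N p \<theta> P' = {P \<in> borel_prob. wasserstein N p P P' \<le> ennreal \<theta>}"

text \<open>The Bochner integral is 0 for a law without a mean. This default is never relevant for
  \<open>p \<ge> 1\<close>: the laws in \<open>borel_prob_moment N p\<close>, and hence those in a
  Wasserstein ball around one of them, are integrable.\<close>

definition mean :: "'a::euclidean_space measure \<Rightarrow> 'a" where
  "mean P = (\<integral>x. x \<partial>P)"

definition mean_set ::
    "('a::euclidean_space \<Rightarrow> real) \<Rightarrow> real \<Rightarrow> real \<Rightarrow> 'a measure \<Rightarrow> 'a set" where
  "mean_set N p \<theta> P' = {y. \<exists>P \<in> wasserstein_ball N p \<theta> P'. y = mean P}"

end

theory Submission
  imports Defs
begin

text \<open>
  The inclusion of the ball in the set of means is realised by translations: shifting \<open>P'\<close> by a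
  vector \<open>v\<close> shifts its mean by \<open>v\<close>, and the coupling that moves every point by the same \<open>v\<close>
  costs \<open>N v powr p\<close>, so the shifted law has distance at most \<open>N v\<close> whatever \<open>p\<close> is.

  For the converse, let \<open>P\<close> lie in the Wasserstein ball and fix any \<open>t > \<theta>\<close>. Some coupling of
  \<open>P\<close> and \<open>P'\<close> has cost below \<open>t powr p\<close> (\<open>coupling_of_cost_below\<close>; an optimal coupling is
  avoided, hence the slack). Under it, the difference of the two
  coordinates has mean \<open>mean P - mean P'\<close>, and Jensen's inequality, applied to the convex
  functions \<open>N\<close> and \<open>s \<mapsto> s powr p\<close>, bounds the \<open>N\<close>-norm of that mean by \<open>t\<close>
  (\<open>is_norm_expectation_le\<close>). Now let \<open>t\<close> tend to \<open>\<theta>\<close>.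
  The existence of the means rests on the fact that \<open>N\<close> dominates a multiple of the Euclidean
  norm, so that a finite \<open>p\<close>-th moment with respect to \<open>N\<close> gives Bochner integrability.
\<close>

lemma is_norm_nonneg: "is_norm N \<Longrightarrow> 0 \<le> N x"
  by (simp add: is_norm_def)

lemma is_norm_convex_on: "is_norm N \<Longrightarrow> convex_on UNIV N"
  unfolding convex_on_def is_norm_def by (smt (verit) convex_UNIV)

text \<open>In finite dimension convexity already forces continuity.\<close>

lemma is_norm_continuous_on:
  fixes N :: "'a::euclidean_space \<Rightarrow> real"
  shows "is_norm N \<Longrightarrow> continuous_on UNIV N"
  by (rule convex_on_continuous[OF open_UNIV is_norm_convex_on])

lemma is_norm_borel_measurable:
  fixes N :: "'a::euclidean_space \<Rightarrow> real"
  shows "is_norm N \<Longrightarrow> N \<in> borel_measurable borel"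
  by (rule borel_measurable_continuous_onI[OF is_norm_continuous_on])

text \<open>The half of the equivalence of norms that integrability needs: by compactness, \<open>N\<close> attains
  a positive minimum on the Euclidean unit sphere, and homogeneity does the rest.\<close>

lemma is_norm_dominates_norm:
  fixes N :: "'a::euclidean_space \<Rightarrow> real"
  assumes "is_norm N"
  obtains c where "\<And>x. norm x \<le> c * N x"
proof -
  have "compact (sphere (0::'a) 1)" "sphere (0::'a) 1 \<noteq> {}"
    by simp_all
  then obtain u where u: "u \<in> sphere 0 1" and umin: "\<And>x. x \<in> sphere 0 1 \<Longrightarrow> N u \<le> N x"
    using continuous_attains_inf[of "sphere 0 1" N] 
      continuous_on_subset[OF is_norm_continuous_on[OF assms]] by (metis subset_UNIV)
  have "N u > 0"
    using u assms by (force simp: is_norm_def less_le)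
  have "norm x \<le> (1 / N u) * N x" for x
  proof (cases "x = 0")
    case False
    then have "N u \<le> N ((1 / norm x) *\<^sub>R x)"
      by (intro umin) simp
    also have "\<dots> = N x / norm x"
      using assms by (simp add: is_norm_def)
    finally show ?thesis
      using False \<open>N u > 0\<close> by (simp add: field_simps)
  qed (use assms in \<open>simp add: is_norm_def\<close>)
  then show thesis by (rule that)
qed

text \<open>Jensen's inequality for vector-valued random variables. The epigraph of \<open>f\<close> is closed and
  convex; were the point of expectations outside it, a separating affine functional would be
  bounded away from its value there on all values of \<open>(X, f X)\<close>, which contradicts linearity of
  the expectation.\<close>

lemma (in prob_space) jensens_inequality_euclidean:
  fixes X :: "'a \<Rightarrow> 'b::euclidean_space" and f :: "'b \<Rightarrow> real"
  assumes f: "convex_on UNIV f"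
    and X: "integrable M X" and fX: "integrable M (\<lambda>x. f (X x))"
  shows "f (expectation X) \<le> expectation (\<lambda>x. f (X x))"
proof (rule ccontr)
  let ?e = "(expectation X, expectation (\<lambda>x. f (X x)))"
  assume "\<not> ?thesis"
  then have outside: "?e \<notin> epigraph UNIV f"
    by (simp add: mem_epigraph)
  have "continuous_on UNIV f"
    by (rule convex_on_continuous[OF open_UNIV f])
  then have "continuous_on UNIV (\<lambda>z::'b \<times> real. f (fst z))"
    by (rule continuous_on_compose2) (auto intro: continuous_intros)
  then have "closed (epigraph UNIV f)"
    unfolding epigraph_def by (simp add: closed_Collect_le continuous_on_snd)
  with outside convex_epigraphI[OF f] obtain a b
    where below: "inner a ?e < b" and above: "\<And>z. z \<in> epigraph UNIV f \<Longrightarrow> b < inner a z"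
    using separating_hyperplane_closed_point by meson
  obtain u s where a: "a = (u, s)" by (cases a)
  have "b \<le> expectation (\<lambda>x. inner u (X x) + s * f (X x))"
  proof (rule integral_ge_const)
    show "integrable M (\<lambda>x. inner u (X x) + s * f (X x))"
      using X fX by auto
    show "AE x in M. b \<le> inner u (X x) + s * f (X x)"
      using above[of "(X x, f (X x))" for x] by (auto simp: a mem_epigraph less_imp_le)
  qed
  also have "\<dots> = inner a ?e"
    using X fX by (simp add: a)
  finally show False using below by simp
qed

text \<open>The convex function \<open>s \<mapsto> s powr p\<close> lies above its tangent at \<open>t\<close>, solved here for the
  linear term. For positive \<open>s\<close> this is Young's inequality for \<open>s powr p\<close> and \<open>t powr p\<close> with
  weights \<open>1 / p\<close> and \<open>1 - 1 / p\<close>.\<close>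

lemma powr_above_tangent:
  fixes s t p :: real
  assumes "1 \<le> p" "0 \<le> s" "0 < t"
  shows "s \<le> t + (s powr p - t powr p) / (p * t powr (p - 1))"
proof (cases "s = 0")
  case True
  have "t powr p = t * t powr (p - 1)"
    using assms by (simp add: powr_mult_base)
  then show ?thesis using True assms by (simp add: field_simps)
next
  case False
  have tp: "t powr p = t * t powr (p - 1)"
    using assms by (simp add: powr_mult_base)
  have "(s powr p) powr (1 / p) * (t powr p) powr (1 - 1 / p) 
      \<le> (1 / p) * s powr p + (1 - 1 / p) * t powr p"
    using False assms by (intro Youngs_inequality_0) auto
  moreover have "p * (1 - 1 / p) = p - 1"
    using assms by (simp add: field_simps)
  ultimately have "s * t powr (p - 1) \<le> (1 / p) * s powr p + (1 - 1 / p) * t powr p"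
    using False assms by (simp add: powr_powr)
  then show ?thesis 
    using assms unfolding tp by (simp add: field_simps)
qed

text \<open>Since \<open>s \<le> 1 + s powr p\<close>, finiteness of the \<open>p\<close>-th moment passes to the first.\<close>

lemma (in prob_space) integrable_of_norm_moment:
  fixes N :: "'b::euclidean_space \<Rightarrow> real" and X :: "'a \<Rightarrow> 'b"
  assumes N: "is_norm N" and p: "1 \<le> p" and X[measurable]: "X \<in> borel_measurable M"
    and fin: "(\<integral>\<^sup>+ x. ennreal (N (X x) powr p) \<partial>M) < \<infinity>"
  shows "integrable M (\<lambda>x. N (X x) powr p)" "integrable M (\<lambda>x. N (X x))" "integrable M X"
proof -
  note [measurable] = is_norm_borel_measurable[OF N]
  show pth: "integrable M (\<lambda>x. N (X x) powr p)"
    by (rule integrableI_nonneg) (use fin in auto)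
  have le: "s \<le> 1 + s powr p" if "0 \<le> s" for s :: real
    using that p powr_mono[of 1 p s] by (cases "s \<le> 1") (auto intro: add_increasing2)
  show first: "integrable M (\<lambda>x. N (X x))"
    by (rule Bochner_Integration.integrable_bound[OF Bochner_Integration.integrable_add[OF integrable_const[of 1] pth]])
      (use le is_norm_nonneg[OF N] in \<open>auto simp: abs_of_nonneg\<close>)
  obtain c where c: "\<And>x. norm x \<le> c * N x"
    using is_norm_dominates_norm[OF N] by blast
  show "integrable M X"
    by (rule Bochner_Integration.integrable_bound[OF integrable_mult_right[OF first, of c]])
      (use c in \<open>auto intro: order_trans[OF _ abs_ge_self]\<close>)
qed

text \<open>Jensen's inequality twice, for \<open>N\<close> and for \<open>s \<mapsto> s powr p\<close>. The second use
  takes the form of the tangent bound at \<open>t\<close>, which covers the boundary value \<open>0\<close> of \<open>N\<close> and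
  becomes the claim once the \<open>p\<close>-th moment is at most \<open>t powr p\<close>.\<close>

lemma (in prob_space) is_norm_expectation_le:
  fixes N :: "'b::euclidean_space \<Rightarrow> real" and X :: "'a \<Rightarrow> 'b"
  assumes N: "is_norm N" and p: "1 \<le> p" and t: "0 < t" and X: "X \<in> borel_measurable M"
    and moment: "(\<integral>\<^sup>+ x. ennreal (N (X x) powr p) \<partial>M) \<le> ennreal (t powr p)"
  shows "N (expectation X) \<le> t"
proof -
  let ?k = "p * t powr (p - 1)"
  have "(\<integral>\<^sup>+ x. ennreal (N (X x) powr p) \<partial>M) < \<infinity>"
    using moment by (simp add: order_le_less_trans)
  note int = integrable_of_norm_moment[OF N p X this]
  have "expectation (\<lambda>x. N (X x) powr p) \<le> t powr p"
    using moment int(1) by (simp add: nn_integral_eq_integral)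
  moreover have "0 \<le> ?k" using p by simp
  ultimately have small: "(expectation (\<lambda>x. N (X x) powr p) - t powr p) / ?k \<le> 0"
    by (simp add: divide_nonpos_nonneg)
  have "N (expectation X) \<le> expectation (\<lambda>x. N (X x))"
    by (rule jensens_inequality_euclidean[OF is_norm_convex_on[OF N] int(3) int(2)])
  also have "\<dots> \<le> expectation (\<lambda>x. t + (N (X x) powr p - t powr p) / ?k)"
    by (rule integral_mono)
      (use int powr_above_tangent[OF p is_norm_nonneg[OF N] t] in \<open>auto simp: integrable_const\<close>)
  also have "\<dots> = t + (expectation (\<lambda>x. N (X x) powr p) - t powr p) / ?k"
    using int by (simp add: prob_space)
  finally show ?thesis using small by simp
qed

text \<open>A distance below \<open>t\<close> yields an actual coupling; the infimum over an empty set of couplings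
  is infinite and cannot be below \<open>t powr p\<close>.\<close>

lemma coupling_of_cost_below:
  assumes p: "1 \<le> p" and \<theta>: "0 < \<theta>" "\<theta> < t" and W: "wasserstein N p P P' \<le> ennreal \<theta>"
  obtains \<pi> where "\<pi> \<in> couplings P P'"
    "(\<integral>\<^sup>+ z. ennreal (N (fst z - snd z) powr p) \<partial>\<pi>) < ennreal (t powr p)"
proof -
  define C where "C = (INF \<pi>\<in>couplings P P'. \<integral>\<^sup>+ z. ennreal (N (fst z - snd z) powr p) \<partial>\<pi>)"
  have W: "ennreal_powr C (1 / p) \<le> ennreal \<theta>"
    using W by (simp add: wasserstein_def C_def)
  then have fin: "C \<noteq> \<infinity>"
    by (auto simp: ennreal_powr_def top_unique)
  with W have "enn2real C powr (1 / p) \<le> \<theta>"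
    using \<theta> by (simp add: ennreal_powr_def)
  then have "(enn2real C powr (1 / p)) powr p \<le> \<theta> powr p"
    using p by (intro powr_mono2) auto
  also have "\<dots> < t powr p"
    using p \<theta> by (intro powr_less_mono2) auto
  finally have "enn2real C < t powr p"
    using p by (simp add: powr_powr)
  then have "C < ennreal (t powr p)"
    using fin by (metis ennreal_enn2real_if enn2real_nonneg ennreal_less_iff infinity_ennreal_def)
  then show thesis
    unfolding C_def INF_less_iff using that by blast
qed

lemma mean_set_subset_norm_ball:
  fixes N :: "'a::euclidean_space \<Rightarrow> real"
  assumes N: "is_norm N" and p: "1 \<le> p" and \<theta>: "0 < \<theta>" and P': "P' \<in> borel_prob_moment N p"
  shows "mean_set N p \<theta> P' \<subseteq> norm_ball N \<theta> (mean P')"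
proof -
  note [measurable] = is_norm_borel_measurable[OF N]
  have "N (mean P - mean P') \<le> t" if W: "wasserstein N p P P' \<le> ennreal \<theta>" and t: "\<theta> < t" for P t
  proof -
    obtain \<pi> where \<pi>: "\<pi> \<in> couplings P P'"
      and cost: "(\<integral>\<^sup>+ z. ennreal (N (fst z - snd z) powr p) \<partial>\<pi>) < ennreal (t powr p)"
      using coupling_of_cost_below[OF p \<theta> t W] by blast
    have [measurable_cong]: "sets \<pi> = sets (borel \<Otimes>\<^sub>M borel)"
      and P: "P = distr \<pi> borel fst" and P'_distr: "P' = distr \<pi> borel snd"
      using \<pi> by (auto simp: couplings_def)
    interpret prob_space \<pi> using \<pi> by (simp add: couplings_def)
    have "(\<integral>\<^sup>+ z. ennreal (N (snd z) powr p) \<partial>\<pi>) < \<infinity>"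
      using P' by (simp add: borel_prob_moment_def P'_distr nn_integral_distr)
    then have snd: "integrable \<pi> snd"
      by (intro integrable_of_norm_moment(3)[OF N p]) simp_all
    have diff: "integrable \<pi> (\<lambda>z. fst z - snd z)"
      using order.strict_trans[OF cost ennreal_less_top]
      by (intro integrable_of_norm_moment(3)[OF N p]) simp_all
    have "mean P = expectation (\<lambda>z. (fst z - snd z) + snd z)"
      by (simp add: mean_def P integral_distr)
    also have "\<dots> = expectation (\<lambda>z. fst z - snd z) + mean P'"
      unfolding Bochner_Integration.integral_add[OF diff snd] 
      by (simp add: mean_def P'_distr integral_distr)
    finally have "mean P - mean P' = expectation (\<lambda>z. fst z - snd z)" by simp
    also have "N \<dots> \<le> t"
      using \<theta> t cost by (intro is_norm_expectation_le[OF N p]) auto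
    finally show ?thesis .
  qed
  then have "N (mean P - mean P') \<le> \<theta>" if "wasserstein N p P P' \<le> ennreal \<theta>" for P
    using that dense_ge by blast
  then show ?thesis
    by (auto simp: mean_set_def wasserstein_ball_def norm_ball_def)
qed

lemma norm_ball_subset_mean_set:
  fixes N :: "'a::euclidean_space \<Rightarrow> real"
  assumes N: "is_norm N" and p: "1 \<le> p" and P': "P' \<in> borel_prob_moment N p"
  shows "norm_ball N \<theta> (mean P') \<subseteq> mean_set N p \<theta> P'"
proof
  fix y assume "y \<in> norm_ball N \<theta> (mean P')"
  define v where "v = y - mean P'"
  have v: "N v \<le> \<theta>"
    using \<open>y \<in> _\<close> by (simp add: norm_ball_def v_def)
  define P where "P = distr P' borel (\<lambda>x. x + v)"
  define \<pi> where "\<pi> = distr P' (borel \<Otimes>\<^sub>M borel) (\<lambda>x. (x + v, x))"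
  note [measurable] = is_norm_borel_measurable[OF N]
  have sets[measurable_cong]: "sets P' = sets borel"
    using P' by (simp add: borel_prob_moment_def borel_prob_def)
  interpret prob_space P' using P' by (simp add: borel_prob_moment_def borel_prob_def)
  have P: "P \<in> borel_prob"
    by (simp add: borel_prob_def P_def prob_space_distr)
  have "distr P' borel (\<lambda>x. x) = P'"
    by (rule distr_id2) (simp add: sets)
  then have coupling: "\<pi> \<in> couplings P P'"
    by (auto simp: couplings_def \<pi>_def P_def prob_space_distr distr_distr comp_def)
  have cost_\<pi>: "(\<integral>\<^sup>+ z. ennreal (N (fst z - snd z) powr p) \<partial>\<pi>) = ennreal (N v powr p)"
    by (simp add: \<pi>_def nn_integral_distr emeasure_space_1)
  define C where
    "C = (INF \<pi>\<in>couplings P P'. \<integral>\<^sup>+ z. ennreal (N (fst z - snd z) powr p) \<partial>\<pi>)"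
  have cost: "C \<le> ennreal (N v powr p)"
    unfolding C_def by (rule INF_lower2[OF coupling]) (simp add: cost_\<pi>)
  then have "enn2real C \<le> N v powr p"
    by (simp add: enn2real_leI)
  then have "enn2real C powr (1 / p) \<le> (N v powr p) powr (1 / p)"
    using p by (intro powr_mono2) auto
  also have "\<dots> = N v"
    using p is_norm_nonneg[OF N] by (simp add: powr_powr)
  finally have "ennreal (enn2real C powr (1 / p)) \<le> ennreal \<theta>"
    using v by (intro ennreal_leI) simp
  moreover have "C \<noteq> \<infinity>"
    using cost by (metis ennreal_neq_top infinity_ennreal_def top_unique)
  ultimately have W: "wasserstein N p P P' \<le> ennreal \<theta>"
    unfolding wasserstein_def C_def[symmetric] ennreal_powr_def by simp
  have "integrable P' (\<lambda>x. x)"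
    using P' by (intro integrable_of_norm_moment(3)[OF N p]) (auto simp: borel_prob_moment_def)
  then have "expectation (\<lambda>x. x + v) = mean P' + v"
    by (simp add: mean_def prob_space)
  moreover have "mean P = expectation (\<lambda>x. x + v)"
    by (simp add: mean_def P_def integral_distr)
  ultimately have "mean P = y"
    by (simp add: v_def)
  with P W show "y \<in> mean_set N p \<theta> P'"
    by (auto simp: mean_set_def wasserstein_ball_def)
qed

theorem theorem2p4:
  fixes N :: "real ^ 'm \<Rightarrow> real"
    and p \<theta> :: real
    and P' :: "(real ^ 'm) measure"
  assumes "is_norm N"
    and "p \<ge> 1"
    and "\<theta> > 0"
    and "P' \<in> borel_prob_moment N p"
  shows "mean_set N p \<theta> P' = norm_ball N \<theta> (mean P')"
  using mean_set_subset_norm_ball[OF assms] norm_ball_subset_mean_set[OF assms(1,2,4)] by blast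

end
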